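(* Let $p$ be a prime and let $Y \in \mathcal{C}(\mathbb{Z}_p)$. Then for any rational number $r \in \mathbb{Q} \cap \mathbb{Z}_p$, the dilated set $$rY := \{ ry : y \in Y\}$$ satisfies $rY \in \mathcal{C}(\mathbb{Z}_p)$.
   Context: Let $\mathcal{A}$ be a finite alphabet and $\mathbb{N}=\{0,1,2,\dots\}$. A pointed labeled graph $(\mathcal{G},v)$ over $\mathcal{A}$ consists of a finite directed graph (loops and multiple edges allowed) whose edges are labeled by elements of $\mathcal{A}$, with a marked vertex $v$. Its path set $X_{\mathcal{G}}(v) \subset \mathcal{A}^{\mathbb{N}}$ is the set of label sequences of all one-sided infinite directed walks in $\mathcal{G}$ starting at $v$. Given a digit assignment map $\bar f_p: \mathcal{A} \to \{0,1,\dots,p-1\}$ (not necessarily injective), let $f_p: \mathcal{A}^{\mathbb{N}} \to \mathbb{Z}_p$, $f_p(a_0a_1a_2\cdots) = \sum_{k\ge 0} \bar f_p(a_k)p^k$. A $p$-adic path set fractal is a set of the form $Y = f_p(X_{\mathcal{G}}(v)) \subset \mathbb{Z}_p$ for some such data $(\bar f_p,\mathcal{G},v)$. $\mathcal{C}(\mathbb{Z}_p)$ denotes the collection of all $p$-adic path set fractals. *)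

theory Defs
  imports "HOL-Analysis.Function_Topology"
    "HOL-Computational_Algebra.Primes" "Graph_Theory.Digraph" "HOL-Algebra.Ring"
begin

section \<open>The ring of p-adic integers\<close>

text \<open>
  The inverse limit of the rings \<open>\<int>/p\<^sup>n\<int>\<close>: an element is the coherent sequence of its
  canonical residues modulo \<open>p\<^sup>n\<close>. The \<open>p\<close>-adic topology is the subspace topology of the
  product of the discrete spaces \<open>\<int>/p\<^sup>n\<int>\<close>, so \<open>p\<close>-adic convergence is convergence in the
  library's product topology on \<^typ>\<open>nat \<Rightarrow> int\<close> (\<^typ>\<open>int\<close> is discrete).
\<close>

definition padic_ints :: "nat \<Rightarrow> (nat \<Rightarrow> int) ring" where
  "padic_ints p = \<lparr>
     carrier = {x. \<forall>n. 0 \<le> x n \<and> x n < int p ^ n \<and> x (Suc n) mod int p ^ n = x n},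
     mult = (\<lambda>x y n. (x n * y n) mod int p ^ n),
     one = (\<lambda>n. 1 mod int p ^ n),
     zero = (\<lambda>n. 0),
     add = (\<lambda>x y n. (x n + y n) mod int p ^ n)\<rparr>"

text \<open>
  \<open>\<rat> \<inter> \<int>\<^sub>p\<close>: the \<open>x \<in> \<int>\<^sub>p\<close> with \<open>x = a / b\<close> for integers \<open>a\<close> and \<open>b \<noteq> 0\<close>.
  In lowest terms these are the fractions with \<open>p\<close> not dividing \<open>b\<close>; see
  \<open>padic_fraction_iff\<close> and \<open>padic_fraction_unique\<close> below.
\<close>

definition padic_rationals :: "nat \<Rightarrow> (nat \<Rightarrow> int) set" where
  "padic_rationals p = {x \<in> carrier (padic_ints p).
     \<exists>(a :: int) (b :: int). b \<noteq> 0 \<and> [b] \<cdot>\<^bsub>padic_ints p\<^esub> x = [a] \<cdot>\<^bsub>padic_ints p\<^esub> \<one>\<^bsub>padic_ints p\<^esub>}"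

text \<open>
  \<open>\<Sum>k. f (w k) p\<^sup>k\<close>, the \<open>p\<close>-adic limit of the partial sums. The limit always exists and is
  unique, with closed form \<open>padic_of_word_eq\<close> below.
\<close>

definition padic_of_word :: "nat \<Rightarrow> ('a \<Rightarrow> nat) \<Rightarrow> (nat \<Rightarrow> 'a) \<Rightarrow> (nat \<Rightarrow> int)" where
  "padic_of_word p f w = (THE x.
     (\<lambda>m. \<Oplus>\<^bsub>padic_ints p\<^esub>k\<in>{..<m}. [f (w k)] \<cdot>\<^bsub>padic_ints p\<^esub>
        (([p] \<cdot>\<^bsub>padic_ints p\<^esub> \<one>\<^bsub>padic_ints p\<^esub>) [^]\<^bsub>padic_ints p\<^esub> k)) \<longlonglongrightarrow> x)"


section \<open>Path sets and path set fractals\<close>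

definition pointed_labeled_graph ::
    "'a set \<Rightarrow> ('v, 'e) pre_digraph \<Rightarrow> ('e \<Rightarrow> 'a) \<Rightarrow> 'v \<Rightarrow> bool" where
  "pointed_labeled_graph A G lab v \<longleftrightarrow> fin_digraph G \<and> lab ` arcs G \<subseteq> A \<and> v \<in> verts G"

definition path_set :: "('v, 'e) pre_digraph \<Rightarrow> ('e \<Rightarrow> 'a) \<Rightarrow> 'v \<Rightarrow> (nat \<Rightarrow> 'a) set" where
  "path_set G lab v = {\<lambda>k. lab (e k) | e.
     (\<forall>k. e k \<in> arcs G) \<and> tail G (e 0) = v \<and> (\<forall>k. head G (e k) = tail G (e (Suc k)))}"

text \<open>
  The alphabet, like the graph, is part of the data. Letters, vertices and arcs are natural
  numbers only because one cannot quantify existentially over types; by \<open>path_set_fractalsI\<close>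
  below, data over arbitrary types give nothing more.
\<close>

definition path_set_fractals :: "nat \<Rightarrow> (nat \<Rightarrow> int) set set" where
  "path_set_fractals p = {padic_of_word p f ` path_set G lab v | (A :: nat set) f
       (G :: (nat, nat) pre_digraph) lab v.
     finite A \<and> f ` A \<subseteq> {..<p} \<and> pointed_labeled_graph A G lab v}"


section \<open>Basic facts\<close>

lemma padic_ints_simps [simp]:
  "x \<otimes>\<^bsub>padic_ints p\<^esub> y = (\<lambda>n. (x n * y n) mod int p ^ n)"
  "x \<oplus>\<^bsub>padic_ints p\<^esub> y = (\<lambda>n. (x n + y n) mod int p ^ n)"
  "\<one>\<^bsub>padic_ints p\<^esub> = (\<lambda>n. 1 mod int p ^ n)"
  "\<zero>\<^bsub>padic_ints p\<^esub> = (\<lambda>n. 0)"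
  by (simp_all add: padic_ints_def)

lemma padic_carrier_iff:
  "x \<in> carrier (padic_ints p) \<longleftrightarrow>
     (\<forall>n. 0 \<le> x n \<and> x n < int p ^ n \<and> x (Suc n) mod int p ^ n = x n)"
  by (simp add: padic_ints_def)

lemma padic_carrier_mod:
  "x \<in> carrier (padic_ints p) \<Longrightarrow> x n mod int p ^ n = x n"
  by (simp add: padic_carrier_iff)

lemma mod_Suc_mod:
  "(z :: int) mod int p ^ Suc n mod int p ^ n = z mod int p ^ n"
  by (rule mod_mod_cancel) (rule le_imp_power_dvd, simp)

text \<open>The residue sequence of any coherent integer sequence lies in the ring.\<close>

lemma padic_carrierI:
  assumes "p > 0" "\<And>n. z (Suc n) mod int p ^ n = z n mod int p ^ n"
  shows "(\<lambda>n. z n mod int p ^ n) \<in> carrier (padic_ints p)"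
  using assms(1) by (simp add: padic_carrier_iff mod_Suc_mod assms(2) del: power_Suc)

lemma padic_coherent:
  "x \<in> carrier (padic_ints p) \<Longrightarrow> x (Suc n) mod int p ^ n = x n mod int p ^ n"
  by (simp add: padic_carrier_iff)

lemma padic_cring:
  assumes p: "p > 0"
  shows "cring (padic_ints p)"
proof (rule cringI)
  show "abelian_group (padic_ints p)"
  proof (rule abelian_groupI)
    fix x y assume "x \<in> carrier (padic_ints p)" "y \<in> carrier (padic_ints p)"
    then show "x \<oplus>\<^bsub>padic_ints p\<^esub> y \<in> carrier (padic_ints p)"
      unfolding padic_ints_simps
      by (intro padic_carrierI[OF p] mod_add_cong padic_coherent)
  next
    fix x assume x: "x \<in> carrier (padic_ints p)"
    have "(\<lambda>n. (- x n) mod int p ^ n) \<in> carrier (padic_ints p)"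
      by (intro padic_carrierI[OF p] mod_minus_cong padic_coherent x)
    then show "\<exists>y\<in>carrier (padic_ints p). y \<oplus>\<^bsub>padic_ints p\<^esub> x = \<zero>\<^bsub>padic_ints p\<^esub>"
      by (rule bexI[rotated]) (simp add: mod_add_left_eq)
  next
    show "\<zero>\<^bsub>padic_ints p\<^esub> \<in> carrier (padic_ints p)"
      using p by (simp add: padic_carrier_iff)
  qed (auto simp: padic_carrier_mod mod_add_left_eq mod_add_right_eq algebra_simps)
next
  show "Group.comm_monoid (padic_ints p)"
  proof (rule comm_monoidI)
    fix x y assume "x \<in> carrier (padic_ints p)" "y \<in> carrier (padic_ints p)"
    then show "x \<otimes>\<^bsub>padic_ints p\<^esub> y \<in> carrier (padic_ints p)"
      unfolding padic_ints_simps
      by (intro padic_carrierI[OF p] mod_mult_cong padic_coherent)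
  next
    show "\<one>\<^bsub>padic_ints p\<^esub> \<in> carrier (padic_ints p)"
      unfolding padic_ints_simps by (rule padic_carrierI[OF p]) simp
  qed (auto simp: padic_carrier_mod mod_mult_left_eq mod_mult_right_eq algebra_simps)
qed (auto simp: mod_mult_left_eq mod_simps algebra_simps)

lemma padic_add_pow_nat:
  assumes "p > 0" "x \<in> carrier (padic_ints p)"
  shows "[(k :: nat)] \<cdot>\<^bsub>padic_ints p\<^esub> x = (\<lambda>n. (int k * x n) mod int p ^ n)"
proof (induction k)
  case 0
  then show ?case by (simp add: add_pow_def)
next
  case (Suc k)
  then show ?case by (simp add: add_pow_def mod_simps algebra_simps)
qed

lemma padic_add_pow_int:
  assumes p: "p > 0" and x: "x \<in> carrier (padic_ints p)"
  shows "[(k :: int)] \<cdot>\<^bsub>padic_ints p\<^esub> x = (\<lambda>n. (k * x n) mod int p ^ n)"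
proof (cases "k \<ge> 0")
  case True
  then show ?thesis by (simp add: add_pow_int_ge padic_add_pow_nat[OF assms])
next
  case False
  interpret cring "padic_ints p" by (rule padic_cring[OF p])
  let ?u = "\<lambda>n. (- k * x n) mod int p ^ n" and ?v = "\<lambda>n. (k * x n) mod int p ^ n"
  have "?u \<in> carrier (padic_ints p)" "?v \<in> carrier (padic_ints p)"
    by (intro padic_carrierI[OF p] mod_mult_cong padic_coherent x refl)+
  moreover have "?v \<oplus>\<^bsub>padic_ints p\<^esub> ?u = \<zero>\<^bsub>padic_ints p\<^esub>"
    by (simp add: mod_simps)
  ultimately have "\<ominus>\<^bsub>padic_ints p\<^esub> ?u = ?v" by (intro minus_equality)
  then show ?thesis using False
    by (simp add: add_pow_int_lt padic_add_pow_nat[OF assms])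
qed

lemma padic_int_mult_one:
  assumes "p > 0"
  shows "[(k :: int)] \<cdot>\<^bsub>padic_ints p\<^esub> \<one>\<^bsub>padic_ints p\<^esub> = (\<lambda>n. k mod int p ^ n)"
proof -
  interpret cring "padic_ints p" by (rule padic_cring[OF assms])
  show ?thesis by (subst padic_add_pow_int[OF assms one_closed]) (simp add: mod_simps)
qed

lemma padic_fraction_iff:
  assumes p: "prime p" and "coprime a b"
  shows "(\<exists>x\<in>carrier (padic_ints p).
           [b] \<cdot>\<^bsub>padic_ints p\<^esub> x = [a] \<cdot>\<^bsub>padic_ints p\<^esub> \<one>\<^bsub>padic_ints p\<^esub>) \<longleftrightarrow> \<not> int p dvd b"
proof
  have p0: "p > 0" using p by (rule prime_gt_0_nat)
  assume "\<exists>x\<in>carrier (padic_ints p).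
           [b] \<cdot>\<^bsub>padic_ints p\<^esub> x = [a] \<cdot>\<^bsub>padic_ints p\<^esub> \<one>\<^bsub>padic_ints p\<^esub>"
  then obtain x where "x \<in> carrier (padic_ints p)"
    "[b] \<cdot>\<^bsub>padic_ints p\<^esub> x = [a] \<cdot>\<^bsub>padic_ints p\<^esub> \<one>\<^bsub>padic_ints p\<^esub>" by blast
  then have "(b * x n) mod int p ^ n = a mod int p ^ n" for n
    using p0 by (simp add: padic_add_pow_int padic_int_mult_one fun_eq_iff del: padic_ints_simps)
  from this[of 1] have *: "(b * x 1) mod int p = a mod int p" by simp
  show "\<not> int p dvd b"
  proof
    assume b: "int p dvd b"
    then have "int p dvd a" using * by (metis dvd_mult2 dvd_eq_mod_eq_0)
    with b assms have "is_unit (int p)" by (meson coprime_common_divisor)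
    then show False using p by (simp add: prime_nat_iff)
  qed
next
  have p0: "p > 0" using p by (rule prime_gt_0_nat)
  assume "\<not> int p dvd b"
  then have "coprime (int p ^ n) b" for n
    using p by (simp add: prime_imp_coprime)
  then have "\<exists>c. (b * c) mod int p ^ n = 1 mod int p ^ n" for n
    by (metis bezout_int coprime_iff_gcd_eq_1 mod_mult_self1 mult.commute add.commute)
  then obtain c where c: "\<And>n. (b * c n) mod int p ^ n = 1 mod int p ^ n" by metis
  have coh: "(a * c (Suc n)) mod int p ^ n = (a * c n) mod int p ^ n" for n
  proof -
    have "(b * c (Suc n)) mod int p ^ n = 1 mod int p ^ n"
      using c[of "Suc n"] by (metis mod_Suc_mod)
    then have "(c n * (b * c (Suc n))) mod int p ^ n = c n mod int p ^ n"
      by (metis mod_mult_right_eq mult.right_neutral)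
    moreover have "((b * c n) * c (Suc n)) mod int p ^ n = c (Suc n) mod int p ^ n"
      using c[of n] by (metis mod_mult_left_eq mult.left_neutral)
    ultimately have "c (Suc n) mod int p ^ n = c n mod int p ^ n"
      by (simp add: algebra_simps)
    then show ?thesis by (metis mod_mult_right_eq)
  qed
  define x where "x = (\<lambda>n. (a * c n) mod int p ^ n)"
  have x: "x \<in> carrier (padic_ints p)"
    unfolding x_def by (rule padic_carrierI[OF p0 coh])
  have "(b * x n) mod int p ^ n = a mod int p ^ n" for n
  proof -
    have "(b * x n) mod int p ^ n = (a * (b * c n)) mod int p ^ n"
      by (simp add: x_def mod_mult_right_eq algebra_simps)
    also have "\<dots> = a mod int p ^ n" using c[of n] by (metis mod_mult_right_eq mult.right_neutral)
    finally show ?thesis .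
  qed
  then show "\<exists>x\<in>carrier (padic_ints p).
      [b] \<cdot>\<^bsub>padic_ints p\<^esub> x = [a] \<cdot>\<^bsub>padic_ints p\<^esub> \<one>\<^bsub>padic_ints p\<^esub>"
    using x p0 by (intro bexI[of _ x])
      (simp_all add: padic_add_pow_int padic_int_mult_one del: padic_ints_simps)
qed

lemma padic_carrier_mod_le:
  assumes "x \<in> carrier (padic_ints p)"
  shows "x (n + m) mod int p ^ n = x n"
proof (induction m)
  case 0
  then show ?case using assms by (simp add: padic_carrier_mod)
next
  case (Suc m)
  have "x (n + Suc m) mod int p ^ n = x (Suc (n + m)) mod int p ^ (n + m) mod int p ^ n"
    by (simp add: mod_mod_cancel power_add)
  also have "\<dots> = x (n + m) mod int p ^ n"
    using assms by (simp add: padic_carrier_iff)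
  finally show ?case using Suc by simp
qed

lemma padic_fraction_unique:
  assumes p: "prime p" and b: "b \<noteq> (0 :: int)"
    and x: "x \<in> carrier (padic_ints p)" and y: "y \<in> carrier (padic_ints p)"
    and eq: "[b] \<cdot>\<^bsub>padic_ints p\<^esub> x = [b] \<cdot>\<^bsub>padic_ints p\<^esub> y"
  shows "x = y"
proof
  fix n
  have p0: "p > 0" using p by (rule prime_gt_0_nat)
  have pp: "prime (int p)" using p by simp
  obtain k c where bc: "b = int p ^ k * c" and c: "\<not> int p dvd c"
    by (rule multiplicity_decompose'[OF b, of "int p"]) (use pp not_prime_unit in blast)+
  have "(b * x (n + k)) mod int p ^ (n + k) = (b * y (n + k)) mod int p ^ (n + k)"
    using eq p0 x y by (simp add: padic_add_pow_int fun_eq_iff)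
  then have "int p ^ (n + k) dvd b * x (n + k) - b * y (n + k)"
    by (simp add: mod_eq_dvd_iff)
  also have "b * x (n + k) - b * y (n + k) = int p ^ k * (c * (x (n + k) - y (n + k)))"
    by (simp add: bc algebra_simps)
  finally have "int p ^ n dvd c * (x (n + k) - y (n + k))"
    using p0 by (simp add: power_add)
  moreover have "coprime (int p ^ n) c" using pp c by (simp add: prime_imp_coprime)
  ultimately have "int p ^ n dvd x (n + k) - y (n + k)"
    by (simp add: coprime_dvd_mult_right_iff)
  then show "x n = y n"
    using padic_carrier_mod_le[OF x, of n k] padic_carrier_mod_le[OF y, of n k]
    by (metis mod_eq_dvd_iff)
qed

lemma LIMSEQ_fun_int_iff:
  fixes s :: "nat \<Rightarrow> nat \<Rightarrow> int"
  shows "s \<longlonglongrightarrow> x \<longleftrightarrow> (\<forall>n. \<forall>\<^sub>F m in sequentially. s m n = x n)"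
proof -
  have "s \<longlonglongrightarrow> x \<longleftrightarrow> limitin (product_topology (\<lambda>_. euclidean) UNIV) s x sequentially"
    by (simp add: euclidean_product_topology)
  also have "\<dots> \<longleftrightarrow> (\<forall>n. (\<lambda>m. s m n) \<longlonglongrightarrow> x n)"
    by (simp add: limitin_componentwise)
  finally show ?thesis by (simp add: tendsto_discrete)
qed

lemma padic_partial_sum:
  assumes p: "p > 0"
  shows "(\<Oplus>\<^bsub>padic_ints p\<^esub>k\<in>{..<m}. [g k] \<cdot>\<^bsub>padic_ints p\<^esub>
            (([p] \<cdot>\<^bsub>padic_ints p\<^esub> \<one>\<^bsub>padic_ints p\<^esub>) [^]\<^bsub>padic_ints p\<^esub> k)) =
         (\<lambda>n. (\<Sum>k<m. int (g k) * int p ^ k) mod int p ^ n)"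
proof -
  interpret cring "padic_ints p" by (rule padic_cring[OF p])
  have Q: "[p] \<cdot>\<^bsub>padic_ints p\<^esub> \<one>\<^bsub>padic_ints p\<^esub> = (\<lambda>n. int p mod int p ^ n)"
    by (subst padic_add_pow_nat[OF p one_closed]) (simp add: mod_simps)
  have P: "([p] \<cdot>\<^bsub>padic_ints p\<^esub> \<one>\<^bsub>padic_ints p\<^esub>) [^]\<^bsub>padic_ints p\<^esub> k = (\<lambda>n. int p ^ k mod int p ^ n)"
    for k :: nat
    unfolding Q
  proof (induction k)
    case 0
    show ?case by simp
  next
    case (Suc k)
    show ?case by (simp add: Suc mod_mult_eq mult.commute)
  qed
  have C: "(\<lambda>n. int p ^ k mod int p ^ n) \<in> carrier (padic_ints p)" for k
    by (rule padic_carrierI[OF p]) simp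
  have T: "[g k] \<cdot>\<^bsub>padic_ints p\<^esub> (\<lambda>n. int p ^ k mod int p ^ n)
      = (\<lambda>n. (int (g k) * int p ^ k) mod int p ^ n)" for k
    by (subst padic_add_pow_nat[OF p C]) (simp add: mod_simps)
  have D: "(\<lambda>n. (int (g k) * int p ^ k) mod int p ^ n) \<in> carrier (padic_ints p)" for k
    by (rule padic_carrierI[OF p]) simp
  show ?thesis
    unfolding P T
  proof (induction m)
    case 0
    then show ?case by simp
  next
    case (Suc m)
    have "(\<Oplus>\<^bsub>padic_ints p\<^esub>k\<in>{..<Suc m}. (\<lambda>n. (int (g k) * int p ^ k) mod int p ^ n)) =
        (\<lambda>n. (int (g m) * int p ^ m) mod int p ^ n) \<oplus>\<^bsub>padic_ints p\<^esub>
        (\<Oplus>\<^bsub>padic_ints p\<^esub>k\<in>{..<m}. (\<lambda>n. (int (g k) * int p ^ k) mod int p ^ n))"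
      unfolding lessThan_Suc using D by (intro finsum_insert) auto
    then show ?case by (simp add: Suc mod_simps add.commute)
  qed
qed

lemma padic_of_word_sums:
  assumes p: "p > 0"
  shows "(\<lambda>m. \<Oplus>\<^bsub>padic_ints p\<^esub>k\<in>{..<m}. [f (w k)] \<cdot>\<^bsub>padic_ints p\<^esub>
            (([p] \<cdot>\<^bsub>padic_ints p\<^esub> \<one>\<^bsub>padic_ints p\<^esub>) [^]\<^bsub>padic_ints p\<^esub> k))
         \<longlonglongrightarrow> (\<lambda>n. (\<Sum>k<n. int (f (w k)) * int p ^ k) mod int p ^ n)"
  unfolding padic_partial_sum[OF p] LIMSEQ_fun_int_iff
proof
  fix n
  have "(\<Sum>k<m. int (f (w k)) * int p ^ k) mod int p ^ n =
        (\<Sum>k<n. int (f (w k)) * int p ^ k) mod int p ^ n" if "m \<ge> n" for m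
    using that
  proof (induction m rule: dec_induct)
    case (step m)
    then have "int p ^ n dvd int (f (w m)) * int p ^ m" by (simp add: le_imp_power_dvd)
    then show ?case using step.IH by (simp add: mod_add_eq[symmetric])
  qed simp
  then show "\<forall>\<^sub>F m in sequentially. (\<Sum>k<m. int (f (w k)) * int p ^ k) mod int p ^ n =
        (\<Sum>k<n. int (f (w k)) * int p ^ k) mod int p ^ n"
    unfolding eventually_sequentially by blast
qed

lemma padic_of_word_eq:
  assumes p: "p > 0"
  shows "padic_of_word p f w = (\<lambda>n. (\<Sum>k<n. int (f (w k)) * int p ^ k) mod int p ^ n)"
  unfolding padic_of_word_def
proof (rule the_equality, rule padic_of_word_sums[OF p])
  fix x
  assume x: "(\<lambda>m. \<Oplus>\<^bsub>padic_ints p\<^esub>k\<in>{..<m}. [f (w k)] \<cdot>\<^bsub>padic_ints p\<^esub>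
            (([p] \<cdot>\<^bsub>padic_ints p\<^esub> \<one>\<^bsub>padic_ints p\<^esub>) [^]\<^bsub>padic_ints p\<^esub> k)) \<longlonglongrightarrow> x"
  show "x = (\<lambda>n. (\<Sum>k<n. int (f (w k)) * int p ^ k) mod int p ^ n)"
  proof
    fix n
    have "\<forall>\<^sub>F m in sequentially. x n = (\<Sum>k<n. int (f (w k)) * int p ^ k) mod int p ^ n"
      using x[unfolded LIMSEQ_fun_int_iff, THEN spec[of _ n]]
        padic_of_word_sums[OF p, of f w, unfolded LIMSEQ_fun_int_iff, THEN spec[of _ n]]
      by eventually_elim simp
    then show "x n = (\<Sum>k<n. int (f (w k)) * int p ^ k) mod int p ^ n" by simp
  qed
qed

lemma padic_of_word_carrier:
  assumes p: "p > 0"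
  shows "padic_of_word p f w \<in> carrier (padic_ints p)"
  unfolding padic_of_word_eq[OF p] by (rule padic_carrierI[OF p]) simp

lemma path_set_fractalsI:
  fixes A :: "'a set" and G :: "('v, 'e) pre_digraph"
  assumes A: "finite A" and f: "f ` A \<subseteq> {..<p}" and G: "pointed_labeled_graph A G lab v"
  shows "padic_of_word p f ` path_set G lab v \<in> path_set_fractals p"
proof -
  interpret fin_digraph G using G by (simp add: pointed_labeled_graph_def)
  obtain a :: "'a \<Rightarrow> nat" where a: "inj_on a A" using finite_imp_inj_to_nat_seg[OF A] by blast
  obtain b :: "'v \<Rightarrow> nat" where b: "inj_on b (verts G)"
    using finite_imp_inj_to_nat_seg[OF finite_verts] by blast
  obtain c :: "'e \<Rightarrow> nat" where c: "inj_on c (arcs G)"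
    using finite_imp_inj_to_nat_seg[OF finite_arcs] by blast
  define d where "d = inv_into (arcs G) c"
  define f' where "f' = f \<circ> inv_into A a"
  define lab' where "lab' = a \<circ> lab \<circ> d"
  define H where "H = \<lparr>verts = b ` verts G, arcs = c ` arcs G,
    tail = b \<circ> tail G \<circ> d, head = b \<circ> head G \<circ> d\<rparr>"
  have dc: "d (c e) = e" if "e \<in> arcs G" for e
    using that c by (simp add: d_def)
  have lab: "lab e \<in> A" if "e \<in> arcs G" for e
    using G that by (auto simp: pointed_labeled_graph_def)
  have v: "v \<in> verts G" using G by (simp add: pointed_labeled_graph_def)
  have f'a: "f' (a u) = f u" if "u \<in> A" for u
    using that a by (simp add: f'_def)
  have b_eq: "b u = b w \<longleftrightarrow> u = w" if "u \<in> verts G" "w \<in> verts G" for u w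
    using that b by (meson inj_onD)
  have "fin_digraph H"
    by unfold_locales (auto simp: H_def dc)
  moreover have "lab' ` arcs H \<subseteq> a ` A" by (auto simp: lab'_def H_def dc lab)
  ultimately have "pointed_labeled_graph (a ` A) H lab' (b v)"
    using v by (simp add: pointed_labeled_graph_def H_def)
  moreover have "f' ` (a ` A) \<subseteq> {..<p}" using f f'a by auto
  moreover have "padic_of_word p f' ` path_set H lab' (b v) =
      padic_of_word p f ` path_set G lab v"
  proof -
    have val: "padic_of_word p f' (\<lambda>k. lab' (c (e k))) = padic_of_word p f (\<lambda>k. lab (e k))"
      if "\<forall>k. e k \<in> arcs G" for e
      using that by (simp add: padic_of_word_def lab'_def dc f'a lab)
    define E where "E = {e. (\<forall>k. e k \<in> arcs G) \<and> tail G (e 0) = v \<and>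
        (\<forall>k. head G (e k) = tail G (e (Suc k)))}"
    have "path_set H lab' (b v) = (\<lambda>e k. lab' (c (e k))) ` E" (is "_ = ?R")
    proof
      show "path_set H lab' (b v) \<subseteq> ?R"
      proof
        fix w assume "w \<in> path_set H lab' (b v)"
        then obtain e where w: "w = (\<lambda>k. lab' (e k))" and e: "\<And>k. e k \<in> arcs H"
          "tail H (e 0) = b v" "\<And>k. head H (e k) = tail H (e (Suc k))"
          unfolding path_set_def by blast
        have arc: "d (e k) \<in> arcs G" and cd: "c (d (e k)) = e k" for k
          using e(1)[of k] by (auto simp: H_def dc)
        have "tail G (d (e 0)) = v" "head G (d (e k)) = tail G (d (e (Suc k)))" for k
          using e(2) e(3)[of k] arc v by (simp_all add: H_def b_eq)
        then have "(\<lambda>k. d (e k)) \<in> E" using arc by (simp add: E_def)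
        then show "w \<in> ?R" by (rule rev_image_eqI) (simp add: w cd)
      qed
      show "?R \<subseteq> path_set H lab' (b v)"
      proof
        fix w assume "w \<in> ?R"
        then obtain e where w: "w = (\<lambda>k. lab' (c (e k)))" and e: "\<And>k. e k \<in> arcs G"
          "tail G (e 0) = v" "\<And>k. head G (e k) = tail G (e (Suc k))"
          by (auto simp: E_def)
        have "\<forall>k. c (e k) \<in> arcs H" "tail H (c (e 0)) = b v"
          "\<forall>k. head H (c (e k)) = tail H (c (e (Suc k)))"
          using e by (simp_all add: H_def dc)
        then show "w \<in> path_set H lab' (b v)"
          unfolding path_set_def w by (intro CollectI exI[of _ "\<lambda>k. c (e k)"]) simp
      qed
    qed
    moreover have "path_set G lab v = (\<lambda>e k. lab (e k)) ` E"
      by (auto simp: path_set_def E_def)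
    ultimately show ?thesis
      using val by (auto simp: image_image E_def intro!: image_cong)
  qed
  ultimately show ?thesis
    using A unfolding path_set_fractals_def
    by (intro CollectI exI[of _ "a ` A"] exI[of _ f'] exI[of _ H] exI[of _ lab'] exI[of _ "b v"])
      simp
qed

end

theory Submission
  imports Defs
begin

text \<open>
  Let \<open>r = a / b\<close>. Multiplication by \<open>r\<close> can be carried out by a finite automaton that reads the
  digits of \<open>y\<close> and guesses the digits of \<open>z = r y\<close>, checking the equation \<open>b z = a y\<close> from the
  lowest digit upwards. Let \<open>Y\<^sub>k\<close> and \<open>Z\<^sub>k\<close> be the numbers formed by the first \<open>k\<close> digits.
  Then \<open>b z = a y\<close> means that \<open>p\<^sup>k\<close> divides \<open>a Y\<^sub>k - b Z\<^sub>k\<close> for every \<open>k\<close>. The quotient \<open>c\<^sub>k\<close>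
  is the carry after \<open>k\<close> steps; it satisfies \<open>p c\<^sub>k\<^sub>+\<^sub>1 = c\<^sub>k + a y\<^sub>k - b z\<^sub>k\<close>, so that the next carry
  depends only on the present one and on the two digits. Moreover \<open>0 \<le> Y\<^sub>k, Z\<^sub>k < p\<^sup>k\<close> forces
  \<open>\<bar>c\<^sub>k\<bar> \<le> \<bar>a\<bar> + \<bar>b\<bar>\<close>, so only finitely many carries occur (\<open>fraction_digits_iff_carries\<close>).

  Running this automaton along a walk in the graph that presents \<open>Y\<close> gives a finite graph
  whose vertices are pairs of a vertex and a carry. Labeled by the guessed digits, its walks
  from carry \<open>0\<close> spell exactly the digits of the elements of \<open>r Y\<close>: every element of
  \<open>\<int>\<^sub>p\<close> has digits, and \<open>b z = a y\<close> determines \<open>z\<close> because \<open>b \<noteq> 0\<close> and \<open>\<int>\<^sub>p\<close> is an integral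
  domain.
\<close>

section \<open>Digit expansions\<close>

definition digit_sum :: "nat \<Rightarrow> (nat \<Rightarrow> nat) \<Rightarrow> nat \<Rightarrow> int" where
  "digit_sum p d n = (\<Sum>k<n. int (d k) * int p ^ k)"

lemma digit_sum_0 [simp]: "digit_sum p d 0 = 0"
  by (simp add: digit_sum_def)

lemma digit_sum_Suc [simp]: "digit_sum p d (Suc n) = digit_sum p d n + int (d n) * int p ^ n"
  by (simp add: digit_sum_def)

lemma digit_sum_bounds:
  assumes "\<And>k. d k < p"
  shows "0 \<le> digit_sum p d n \<and> digit_sum p d n < int p ^ n"
proof (induction n)
  case 0
  then show ?case by simp
next
  case (Suc n)
  have "int (d n) + 1 \<le> int p" using assms[of n] by simp
  then have "(int (d n) + 1) * int p ^ n \<le> int p * int p ^ n"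
    by (rule mult_right_mono) simp
  moreover have "0 \<le> int (d n) * int p ^ n" by simp
  ultimately show ?case using Suc by (simp add: algebra_simps)
qed

lemma padic_of_word_eq_digit_sum:
  assumes "p > 0" "\<And>k. f (w k) < p"
  shows "padic_of_word p f w n = digit_sum p (\<lambda>k. f (w k)) n"
  using digit_sum_bounds[of "\<lambda>k. f (w k)" p n] assms
  by (simp add: padic_of_word_eq digit_sum_def)

lemma padic_digit_expansion:
  assumes p: "p > 0" and x: "x \<in> carrier (padic_ints p)"
  obtains d where "\<And>k. d k < p" "padic_of_word p id d = x"
proof -
  define d where "d k = nat (x (Suc k) div int p ^ k)" for k
  have digit: "0 \<le> x (Suc k) div int p ^ k \<and> x (Suc k) div int p ^ k < int p" for k
  proof -
    have "0 \<le> x (Suc k)" "x (Suc k) < int p * int p ^ k"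
      using x by (simp_all add: padic_carrier_iff flip: power_Suc)
    moreover have "0 \<le> x (Suc k) mod int p ^ k" using p by simp
    then have "x (Suc k) div int p ^ k * int p ^ k \<le> x (Suc k)"
      using div_mult_mod_eq[of "x (Suc k)" "int p ^ k"] by linarith
    ultimately have "x (Suc k) div int p ^ k * int p ^ k < int p * int p ^ k" by linarith
    then show ?thesis using p \<open>0 \<le> x (Suc k)\<close>
      by (simp add: pos_imp_zdiv_nonneg_iff)
  qed
  have d: "d k < p" for k using digit[of k] by (simp add: d_def nat_less_iff)
  have "digit_sum p d n = x n" for n
  proof (induction n)
    case 0
    have "0 \<le> x 0" "x 0 < int p ^ 0" using x unfolding padic_carrier_iff by blast+
    then show ?case by simp
  next
    case (Suc n)
    have "x (Suc n) = x (Suc n) mod int p ^ n + x (Suc n) div int p ^ n * int p ^ n"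
      by (rule mod_div_mult_eq[symmetric])
    also have "x (Suc n) mod int p ^ n = x n" using x by (simp add: padic_carrier_iff)
    finally show ?case using Suc digit[of n] by (simp add: d_def)
  qed
  then have "padic_of_word p id d = x"
    using padic_of_word_eq_digit_sum[of p id d] p d by (auto simp: fun_eq_iff)
  with d show thesis by (rule that)
qed

section \<open>Multiplication by a fraction\<close>

text \<open>Cancelling \<open>b\<close> is possible because \<open>\<int>\<^sub>p\<close> is a domain of characteristic zero.\<close>

lemma padic_fraction_mult_iff:
  assumes p: "prime p" and r: "r \<in> carrier (padic_ints p)" and b: "b \<noteq> (0 :: int)"
    and eq: "[b] \<cdot>\<^bsub>padic_ints p\<^esub> r = [a] \<cdot>\<^bsub>padic_ints p\<^esub> \<one>\<^bsub>padic_ints p\<^esub>"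
    and y: "y \<in> carrier (padic_ints p)" and z: "z \<in> carrier (padic_ints p)"
  shows "z = r \<otimes>\<^bsub>padic_ints p\<^esub> y \<longleftrightarrow> (\<forall>n. int p ^ n dvd a * y n - b * z n)"
proof -
  have p0: "p > 0" using p by (rule prime_gt_0_nat)
  interpret cring "padic_ints p" by (rule padic_cring[OF p0])
  have ry: "r \<otimes>\<^bsub>padic_ints p\<^esub> y \<in> carrier (padic_ints p)" using r y by (rule m_closed)
  have "(b * r n) mod int p ^ n = a mod int p ^ n" for n
    using fun_cong[OF eq[unfolded padic_int_mult_one[OF p0] padic_add_pow_int[OF p0 r]]] .
  then have "(b * r n * y n) mod int p ^ n = (a * y n) mod int p ^ n" for n
    by (metis mod_mult_left_eq)
  then have b_ry: "[b] \<cdot>\<^bsub>padic_ints p\<^esub> (r \<otimes>\<^bsub>padic_ints p\<^esub> y) = (\<lambda>n. (a * y n) mod int p ^ n)"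
    by (subst padic_add_pow_int[OF p0 ry]) (simp add: mod_simps mult.assoc)
  have "z = r \<otimes>\<^bsub>padic_ints p\<^esub> y \<longleftrightarrow>
      [b] \<cdot>\<^bsub>padic_ints p\<^esub> (r \<otimes>\<^bsub>padic_ints p\<^esub> y) = [b] \<cdot>\<^bsub>padic_ints p\<^esub> z"
    using padic_fraction_unique[OF p b ry z] by auto
  also have "\<dots> \<longleftrightarrow> (\<forall>n. (a * y n) mod int p ^ n = (b * z n) mod int p ^ n)"
    unfolding b_ry padic_add_pow_int[OF p0 z] fun_eq_iff ..
  finally show ?thesis by (simp add: mod_eq_dvd_iff)
qed

definition carry_sequence ::
    "nat \<Rightarrow> int \<Rightarrow> int \<Rightarrow> (nat \<Rightarrow> nat) \<Rightarrow> (nat \<Rightarrow> nat) \<Rightarrow> (nat \<Rightarrow> int) \<Rightarrow> bool" where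
  "carry_sequence p a b d z c \<longleftrightarrow> c 0 = 0 \<and>
     (\<forall>k. \<bar>c k\<bar> \<le> \<bar>a\<bar> + \<bar>b\<bar> \<and> int p * c (Suc k) = c k + a * int (d k) - b * int (z k))"

text \<open>
  The recurrence says precisely that \<open>c\<^sub>k p\<^sup>k = a Y\<^sub>k - b Z\<^sub>k\<close>, so the carries are the quotients in
  the divisibility condition. They are bounded since both partial sums lie below \<open>p\<^sup>k\<close>.
\<close>

lemma fraction_digits_iff_carries:
  assumes p: "p > 0" and d: "\<And>k. d k < p" and z: "\<And>k. z k < p"
  shows "(\<forall>n. int p ^ n dvd a * digit_sum p d n - b * digit_sum p z n) \<longleftrightarrow>
    (\<exists>c. carry_sequence p a b d z c)" (is "?L \<longleftrightarrow> ?R")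
proof
  assume ?L
  then obtain c where c: "a * digit_sum p d n - b * digit_sum p z n = int p ^ n * c n" for n
    unfolding dvd_def by metis
  have "int p ^ k * (int p * c (Suc k)) = int p ^ k * (c k + a * int (d k) - b * int (z k))" for k
    using c[of k] c[of "Suc k"] by (simp add: algebra_simps)
  then have step: "int p * c (Suc k) = c k + a * int (d k) - b * int (z k)" for k
    using p by simp
  have bound: "\<bar>c k\<bar> \<le> \<bar>a\<bar> + \<bar>b\<bar>" for k
  proof -
    have "int p ^ k * \<bar>c k\<bar> = \<bar>a * digit_sum p d k - b * digit_sum p z k\<bar>"
      using c[of k] by (simp add: abs_mult)
    also have "\<dots> \<le> \<bar>a\<bar> * \<bar>digit_sum p d k\<bar> + \<bar>b\<bar> * \<bar>digit_sum p z k\<bar>"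
      by (metis abs_mult abs_triangle_ineq4)
    also have "\<dots> \<le> \<bar>a\<bar> * int p ^ k + \<bar>b\<bar> * int p ^ k"
      using digit_sum_bounds[of d p k, OF d] digit_sum_bounds[of z p k, OF z]
      by (intro add_mono mult_left_mono) auto
    also have "\<dots> = int p ^ k * (\<bar>a\<bar> + \<bar>b\<bar>)" by (simp add: algebra_simps)
    finally show ?thesis using p by simp
  qed
  have "c 0 = 0" using c[of 0] by simp
  with step bound show ?R unfolding carry_sequence_def by blast
next
  assume ?R
  then obtain c where c0: "c 0 = 0"
    and step: "int p * c (Suc k) = c k + a * int (d k) - b * int (z k)" for k
    unfolding carry_sequence_def by blast
  have "int p ^ n * c n = a * digit_sum p d n - b * digit_sum p z n" for n
  proof (induction n)
    case 0
    then show ?case using c0 by simp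
  next
    case (Suc n)
    have "int p ^ Suc n * c (Suc n) = int p ^ n * (int p * c (Suc n))" by (simp add: algebra_simps)
    then show ?case unfolding step using Suc by (simp add: algebra_simps)
  qed
  then show ?L by (metis dvd_triv_left)
qed

section \<open>The graph that presents the dilated set\<close>

text \<open>
  An arc \<open>(e, c, z)\<close> follows the arc \<open>e\<close>, starting with carry \<open>c\<close> and emitting the digit \<open>z\<close>.
  Arcs whose next carry would not be an integer within the bound are discarded, so a walk that
  guesses a wrong digit cannot be continued forever.
\<close>

definition carry_arcs ::
    "nat \<Rightarrow> int \<Rightarrow> int \<Rightarrow> ('e \<Rightarrow> nat) \<Rightarrow> ('v, 'e) pre_digraph \<Rightarrow> ('e \<times> int \<times> nat) set" where
  "carry_arcs p a b g G = {(e, c, z) | e c z. e \<in> arcs G \<and> \<bar>c\<bar> \<le> \<bar>a\<bar> + \<bar>b\<bar> \<and> z < p \<and>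
     int p dvd c + a * int (g e) - b * int z \<and>
     \<bar>(c + a * int (g e) - b * int z) div int p\<bar> \<le> \<bar>a\<bar> + \<bar>b\<bar>}"

definition carry_graph ::
    "nat \<Rightarrow> int \<Rightarrow> int \<Rightarrow> ('e \<Rightarrow> nat) \<Rightarrow> ('v, 'e) pre_digraph \<Rightarrow>
      ('v \<times> int, 'e \<times> int \<times> nat) pre_digraph" where
  "carry_graph p a b g G = \<lparr>verts = verts G \<times> {- (\<bar>a\<bar> + \<bar>b\<bar>)..\<bar>a\<bar> + \<bar>b\<bar>},
     arcs = carry_arcs p a b g G,
     tail = (\<lambda>(e, c, z). (tail G e, c)),
     head = (\<lambda>(e, c, z). (head G e, (c + a * int (g e) - b * int z) div int p))\<rparr>"

abbreviation emitted_digit :: "'e \<times> int \<times> nat \<Rightarrow> nat" where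
  "emitted_digit x \<equiv> snd (snd x)"

lemma pointed_labeled_carry_graph:
  assumes "fin_digraph G" "v \<in> verts G"
  shows "pointed_labeled_graph {..<p} (carry_graph p a b g G) emitted_digit (v, 0)"
proof -
  interpret fin_digraph G by fact
  have "carry_arcs p a b g G \<subseteq> arcs G \<times> {- (\<bar>a\<bar> + \<bar>b\<bar>)..\<bar>a\<bar> + \<bar>b\<bar>} \<times> {..<p}"
    by (auto simp: carry_arcs_def)
  then have "finite (carry_arcs p a b g G)" by (rule finite_subset) simp
  then have "fin_digraph (carry_graph p a b g G)"
    by unfold_locales (auto simp: carry_graph_def carry_arcs_def abs_le_iff)
  then show ?thesis using assms(2)
    by (auto simp: pointed_labeled_graph_def carry_graph_def carry_arcs_def)
qed

text \<open>
  Since each arc stores its own carry, matching heads with tails enforces both that the underlying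
  arcs of \<open>G\<close> fit together and that the stored carries obey the recurrence.
\<close>

lemma path_set_carry_graph:
  assumes p: "p > 0"
  shows "path_set (carry_graph p a b g G) emitted_digit (v, 0) =
    {z. (\<forall>k. z k < p) \<and> (\<exists>e c. (\<forall>k. e k \<in> arcs G) \<and> tail G (e 0) = v \<and>
       (\<forall>k. head G (e k) = tail G (e (Suc k))) \<and> carry_sequence p a b (\<lambda>k. g (e k)) z c)}"
    (is "?L = ?R")
proof
  show "?L \<subseteq> ?R"
  proof
    fix z assume "z \<in> ?L"
    then obtain x where z: "z = (\<lambda>k. emitted_digit (x k))"
      and arc: "\<And>k. x k \<in> carry_arcs p a b g G"
      and start: "tail (carry_graph p a b g G) (x 0) = (v, 0)"
      and walk: "\<And>k. head (carry_graph p a b g G) (x k) = tail (carry_graph p a b g G) (x (Suc k))"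
      unfolding path_set_def by (auto simp: carry_graph_def)
    define e c where "e k = fst (x k)" and "c k = fst (snd (x k))" for k
    have x: "x k = (e k, c k, z k)" for k by (simp add: e_def c_def z)
    have a: "e k \<in> arcs G" "\<bar>c k\<bar> \<le> \<bar>a\<bar> + \<bar>b\<bar>" "z k < p"
      "int p dvd c k + a * int (g (e k)) - b * int (z k)" for k
      using arc[of k] unfolding x carry_arcs_def by auto
    have s: "tail G (e 0) = v" "c 0 = 0" using start by (simp_all add: x carry_graph_def)
    have w: "head G (e k) = tail G (e (Suc k))"
      "c (Suc k) = (c k + a * int (g (e k)) - b * int (z k)) div int p" for k
      using walk[of k] by (simp_all add: x carry_graph_def)
    have "carry_sequence p a b (\<lambda>k. g (e k)) z c"
      unfolding carry_sequence_def using a s w(2) by simp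
    with a s w(1) show "z \<in> ?R" by blast
  qed
  show "?R \<subseteq> ?L"
  proof
    fix z assume "z \<in> ?R"
    then obtain e c where z: "\<And>k. z k < p" and e: "\<And>k. e k \<in> arcs G" "tail G (e 0) = v"
      "\<And>k. head G (e k) = tail G (e (Suc k))"
      and c: "c 0 = 0" "\<And>k. \<bar>c k\<bar> \<le> \<bar>a\<bar> + \<bar>b\<bar>"
      "\<And>k. c k + a * int (g (e k)) - b * int (z k) = int p * c (Suc k)"
      unfolding carry_sequence_def by force
    let ?x = "\<lambda>k. (e k, c k, z k)"
    have "\<forall>k. ?x k \<in> arcs (carry_graph p a b g G)"
      "tail (carry_graph p a b g G) (?x 0) = (v, 0)"
      "\<forall>k. head (carry_graph p a b g G) (?x k) = tail (carry_graph p a b g G) (?x (Suc k))"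
      using z e c p by (simp_all add: carry_graph_def carry_arcs_def)
    then show "z \<in> ?L"
      unfolding path_set_def by (intro CollectI exI[of _ ?x]) simp
  qed
qed

theorem theorem1p4:
  fixes p :: nat and Y :: "(nat \<Rightarrow> int) set" and r :: "nat \<Rightarrow> int"
  assumes "prime p"
    and "Y \<in> path_set_fractals p"
    and "r \<in> padic_rationals p"
  shows "{r \<otimes>\<^bsub>padic_ints p\<^esub> y | y. y \<in> Y} \<in> path_set_fractals p"
proof -
  have p0: "p > 0" using assms(1) by (rule prime_gt_0_nat)
  interpret cring "padic_ints p" by (rule padic_cring[OF p0])
  obtain A :: "nat set" and f and G :: "(nat, nat) pre_digraph" and lab v
    where Y: "Y = padic_of_word p f ` path_set G lab v" and f: "f ` A \<subseteq> {..<p}"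
      and G: "pointed_labeled_graph A G lab v"
    using assms(2) unfolding path_set_fractals_def by blast
  obtain a b :: int where r: "r \<in> carrier (padic_ints p)" and b: "b \<noteq> 0"
    and eq: "[b] \<cdot>\<^bsub>padic_ints p\<^esub> r = [a] \<cdot>\<^bsub>padic_ints p\<^esub> \<one>\<^bsub>padic_ints p\<^esub>"
    using assms(3) unfolding padic_rationals_def by blast
  define g where "g = (\<lambda>e. f (lab e))"
  have g: "g e < p" if "e \<in> arcs G" for e
    using that f G by (auto simp: g_def pointed_labeled_graph_def)
  let ?H = "carry_graph p a b g G"
  have dilate_iff: "padic_of_word p id z = r \<otimes>\<^bsub>padic_ints p\<^esub> padic_of_word p f (\<lambda>k. lab (e k)) \<longleftrightarrow>
      (\<exists>c. carry_sequence p a b (\<lambda>k. g (e k)) z c)"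
    if "\<And>k. e k \<in> arcs G" "\<And>k. z k < p" for e z
    using that g p0
    by (simp add: padic_fraction_mult_iff[OF assms(1) r b eq] padic_of_word_carrier
        padic_of_word_eq_digit_sum fraction_digits_iff_carries[symmetric] g_def
        del: padic_ints_simps)
  have "{r \<otimes>\<^bsub>padic_ints p\<^esub> y | y. y \<in> Y} = padic_of_word p id ` path_set ?H emitted_digit (v, 0)"
  proof (intro equalityI subsetI)
    fix x assume "x \<in> {r \<otimes>\<^bsub>padic_ints p\<^esub> y | y. y \<in> Y}"
    then obtain e where e: "\<And>k. e k \<in> arcs G" "tail G (e 0) = v"
      "\<And>k. head G (e k) = tail G (e (Suc k))"
      and x: "x = r \<otimes>\<^bsub>padic_ints p\<^esub> padic_of_word p f (\<lambda>k. lab (e k))"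
      unfolding Y path_set_def by blast
    have "x \<in> carrier (padic_ints p)"
      unfolding x using r padic_of_word_carrier[OF p0] by (rule m_closed)
    then obtain z where z: "\<And>k. z k < p" and xz: "padic_of_word p id z = x"
      using padic_digit_expansion[OF p0] by metis
    have "\<exists>c. carry_sequence p a b (\<lambda>k. g (e k)) z c"
      using dilate_iff[OF e(1) z] xz x by simp
    then have "z \<in> path_set ?H emitted_digit (v, 0)"
      unfolding path_set_carry_graph[OF p0] using z e by blast
    then show "x \<in> padic_of_word p id ` path_set ?H emitted_digit (v, 0)"
      using xz by blast
  next
    fix x assume "x \<in> padic_of_word p id ` path_set ?H emitted_digit (v, 0)"
    then obtain z e c where x: "x = padic_of_word p id z" and z: "\<And>k. z k < p"
      and e: "\<And>k. e k \<in> arcs G" "tail G (e 0) = v" "\<And>k. head G (e k) = tail G (e (Suc k))"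
      and c: "carry_sequence p a b (\<lambda>k. g (e k)) z c"
      unfolding path_set_carry_graph[OF p0] by blast
    have "x = r \<otimes>\<^bsub>padic_ints p\<^esub> padic_of_word p f (\<lambda>k. lab (e k))"
      unfolding x dilate_iff[OF e(1) z] using c by blast
    moreover have "(\<lambda>k. lab (e k)) \<in> path_set G lab v"
      unfolding path_set_def using e by blast
    ultimately show "x \<in> {r \<otimes>\<^bsub>padic_ints p\<^esub> y | y. y \<in> Y}" unfolding Y by blast
  qed
  moreover have "padic_of_word p id ` path_set ?H emitted_digit (v, 0) \<in> path_set_fractals p"
    using G by (intro path_set_fractalsI[of "{..<p}"] pointed_labeled_carry_graph)
      (auto simp: pointed_labeled_graph_def)
  ultimately show ?thesis by simp
qed

end
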